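(* Let $q$ be a prime power, $F=\mathrm{GF}(q)$, $s\ge 1$ an integer and $n=\frac{q^{s+1}-1}{q-1}$. Let $(C_1,\ldots,C_k)$ be a partition of $F^s$ into $1$-codes. Then there is a partition $(P_1,\ldots,P_{q^{s+1}})$ of $F^n$ into $1$-perfect codes such that for all $j=1,\ldots,k$, $$C_j=\{x\in F^s\mid (1,x,0^{n-s-1})\in P_j\}.$$
   Context: The Hamming distance between two vectors of the same length is the number of positions where they differ. The neighborhood $\Omega(M)$ of a set $M\subset F^N$ is the set of vectors at distance at most $1$ from some element of $M$. A set $C\subset F^N$ is a $1$-code if the neighborhoods of its elements are pairwise disjoint. A $1$-code $P\subset F^N$ is $1$-perfect if $\Omega(P)=F^N$. *)

theory Defs
  imports "HOL-Library.Disjoint_Sets" "HOL-Library.Cardinality" "HOL-Number_Theory.Prime_Powers"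
begin

(* Vectors of F^N are lists of length N over the type 'a. *)

definition words :: "nat \<Rightarrow> 'a list set" where
  "words N = {x. length x = N}"

(* Only meaningful for lists of equal length. *)
definition hamming_dist :: "'a list \<Rightarrow> 'a list \<Rightarrow> nat" where
  "hamming_dist x y = card {i. i < length x \<and> x ! i \<noteq> y ! i}"

definition neighborhood :: "nat \<Rightarrow> 'a list set \<Rightarrow> 'a list set" where
  "neighborhood N M = {y \<in> words N. \<exists>x\<in>M. hamming_dist x y \<le> 1}"

definition one_code :: "nat \<Rightarrow> 'a list set \<Rightarrow> bool" where
  "one_code N C \<longleftrightarrow>
     C \<subseteq> words N \<and> disjoint_family_on (\<lambda>x. neighborhood N {x}) C"

definition one_perfect :: "nat \<Rightarrow> 'a list set \<Rightarrow> bool" where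
  "one_perfect N P \<longleftrightarrow> one_code N P \<and> neighborhood N P = words N"

(* The tuple (C 1, ..., C k) is a partition of A: the cells are nonempty, and
   injectivity makes cells with different indices different, hence disjoint. *)
definition indexed_partition :: "'b set \<Rightarrow> nat \<Rightarrow> (nat \<Rightarrow> 'b set) \<Rightarrow> bool" where
  "indexed_partition A k C \<longleftrightarrow> inj_on C {1..k} \<and> partition_on A (C ` {1..k})"

end

(* Take one column a_p for each point of the projective space PG(s, q), the first s + 1 columns
   being the unit vectors. The fibres of the syndrome map v |-> sum_p v_p a_p are the cosets of a
   Hamming code, and the syndrome maps every radius 1 ball bijectively onto F^(s+1). The word
   w_x = (1, x, 0) has syndrome (1, x). For x in C_j and a fixed representative f x of C_j, the
   components of w_x in the direction d_x = (1, x) - (0, f x) within the cosets of syndromes (1, x)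
   and (0, f x) can be exchanged without destroying bijectivity on balls; afterwards w_x lies in the
   code labelled by (0, f x), which depends only on j. All these switchings can be made at once
   because the components involved are disjoint. This is clear from the syndromes except when
   x, y are distinct words of the same C_j, and then it follows from their distance being at
   least 3. *)

theory Submission
  imports Defs
begin

section \<open>Extending injections between finite sets of equal size\<close>

lemma inj_on_extends_to_bij_betw:
  assumes "finite A" "finite B" "card A = card B" "A' \<subseteq> A" "inj_on h A'" "h ` A' \<subseteq> B"
  obtains g where "bij_betw g A B" "\<And>x. x \<in> A' \<Longrightarrow> g x = h x"
proof -
  have "finite A'" using assms finite_subset by blast
  then have "card (A - A') = card (B - h ` A')"
    using assms by (simp add: card_Diff_subset card_image)
  then obtain e where e: "bij_betw e (A - A') (B - h ` A')"
    using assms finite_same_card_bij[of "A - A'" "B - h ` A'"] by auto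
  define g where "g x = (if x \<in> A' then h x else e x)" for x
  have "bij_betw g A' (h ` A')"
    using assms(5) by (auto simp: bij_betw_def g_def inj_on_def)
  moreover have "bij_betw g (A - A') (B - h ` A')"
    using e by (subst bij_betw_cong[of _ _ e]) (auto simp: g_def)
  ultimately have "bij_betw g (A' \<union> (A - A')) (h ` A' \<union> (B - h ` A'))"
    by (rule bij_betw_combine) auto
  moreover have "A' \<union> (A - A') = A" "h ` A' \<union> (B - h ` A') = B"
    using assms by auto
  ultimately have "bij_betw g A B" by simp
  then show thesis using that g_def by simp
qed

section \<open>Hamming distance, balls of radius 1 and perfect codes\<close>

lemma hamming_dist_commute:
  "length x = length y \<Longrightarrow> hamming_dist x y = hamming_dist y x"
  unfolding hamming_dist_def by (rule arg_cong[of _ _ card]) auto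

lemma hamming_dist_update: "hamming_dist v (v[p := a]) \<le> 1"
proof -
  have "{i. i < length v \<and> v ! i \<noteq> v[p := a] ! i} \<subseteq> {p}"
    by (rule subsetI, rule ccontr) simp
  from card_mono[OF _ this] show ?thesis by (simp add: hamming_dist_def)
qed

lemma hamming_dist_le_1_imp_update:
  assumes "length z = length v" "hamming_dist v z \<le> 1" "v \<noteq> z"
  obtains p where "p < length v" "z = v[p := z ! p]"
proof -
  let ?D = "{i. i < length v \<and> v ! i \<noteq> z ! i}"
  obtain p where p: "p \<in> ?D" using assms nth_equalityI[of v z] by auto
  have "q = p" if "q \<in> ?D" for q
    using assms(2) p that card_le_Suc0_iff_eq[of ?D] by (simp add: hamming_dist_def)
  then have "v ! i = z ! i" if "i < length v" "i \<noteq> p" for i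
    using that by blast
  then have "z = v[p := z ! p]"
    using assms(1) p by (intro nth_equalityI) (auto simp: nth_list_update)
  then show thesis using that p by auto
qed

lemma neighborhood_singleton:
  "neighborhood N {v} = {y \<in> words N. hamming_dist v y \<le> 1}"
  by (simp add: neighborhood_def)

text \<open>Writing the new entry as \<open>v ! p + c\<close> makes the change of the syndrome
  additive: it becomes \<open>c\<close> times column \<open>p\<close>.\<close>

lemma neighborhood_singleton_eq_updates:
  fixes v :: "'f::ab_group_add list"
  assumes "v \<in> words N" "N > 0"
  shows "neighborhood N {v} = {v[p := v ! p + c] | p c. p < N}"
proof (intro set_eqI iffI)
  fix z assume "z \<in> neighborhood N {v}"
  then have z: "length z = length v" "hamming_dist v z \<le> 1"
    using assms by (auto simp: neighborhood_singleton words_def)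
  show "z \<in> {v[p := v ! p + c] | p c. p < N}"
  proof (cases "v = z")
    case True
    \<comment> \<open>The centre of the ball counts as a trivial update at position 0, which exists
      because \<open>N > 0\<close>.\<close>
    then have "z = v[0 := v ! 0 + 0]" by simp
    then show ?thesis using assms by blast
  next
    case False
    then obtain p where p: "p < length v" "z = v[p := z ! p]"
      using hamming_dist_le_1_imp_update[OF z] by blast
    then have "z = v[p := v ! p + (z ! p - v ! p)]" by simp
    then show ?thesis using p(1) assms unfolding words_def by blast
  qed
next
  fix z assume "z \<in> {v[p := v ! p + c] | p c. p < N}"
  then show "z \<in> neighborhood N {v}"
    using assms hamming_dist_update by (auto simp: neighborhood_singleton words_def)
qed

text \<open>If distinct \<open>x\<close> and \<open>y\<close> were at distance at most 2, copying
  one differing entry of \<open>y\<close> into \<open>x\<close> would give a word within distance 1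
  of both.\<close>

lemma one_code_hamming_dist:
  assumes "one_code N C" "x \<in> C" "y \<in> C" "x \<noteq> y"
  shows "hamming_dist x y \<ge> 3"
proof (rule ccontr)
  assume less: "\<not> hamming_dist x y \<ge> 3"
  have len: "length x = N" "length y = N"
    using assms by (auto simp: one_code_def words_def)
  then obtain i where i: "i < N" "x ! i \<noteq> y ! i"
    using assms(4) nth_equalityI[of x y] by auto
  let ?z = "x[i := y ! i]"
  let ?D = "{j. j < length x \<and> x ! j \<noteq> y ! j}"
  have "hamming_dist y ?z = card (?D - {i})"
    unfolding hamming_dist_def using len i
    by (intro arg_cong[of _ _ card]) (auto simp: nth_list_update)
  also have "\<dots> \<le> 1"
    using less i len by (simp add: hamming_dist_def)
  finally have "?z \<in> neighborhood N {y}"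
    using len by (simp add: neighborhood_singleton words_def)
  moreover have "?z \<in> neighborhood N {x}"
    using len hamming_dist_update[of x i] by (simp add: neighborhood_singleton words_def)
  ultimately show False
    using assms by (auto simp: one_code_def disjoint_family_on_def)
qed

text \<open>Lying in a ball is a symmetric relation, so the codewords whose balls contain
  \<open>y\<close> are the elements of the ball of \<open>y\<close> on which \<open>T\<close> takes
  the value \<open>c\<close>. Injectivity on that ball allows at most one of them, which makes the
  balls disjoint; surjectivity provides one, which makes them cover.\<close>

lemma one_perfect_fibre:
  assumes "\<And>v. v \<in> words N \<Longrightarrow> bij_betw T (neighborhood N {v}) U" "c \<in> U"
  shows "one_perfect N {v \<in> words N. T v = c}"
proof -
  let ?P = "{v \<in> words N. T v = c}"
  have sym: "y \<in> neighborhood N {z} \<longleftrightarrow> z \<in> neighborhood N {y}"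
    if "y \<in> words N" "z \<in> words N" for y z :: "'a list"
    using that hamming_dist_commute[of y z] by (auto simp: neighborhood_singleton words_def)
  have "z = z'"
    if "z \<in> ?P" "z' \<in> ?P" "y \<in> neighborhood N {z}" "y \<in> neighborhood N {z'}" for z z' y
  proof -
    have y: "y \<in> words N" using that by (simp add: neighborhood_def)
    then have "z \<in> neighborhood N {y}" "z' \<in> neighborhood N {y}" using that sym by auto
    then show ?thesis using assms(1)[OF y] that by (auto simp: bij_betw_def inj_on_def)
  qed
  then have "one_code N ?P"
    by (auto simp: one_code_def disjoint_family_on_def)
  moreover have "y \<in> neighborhood N ?P" if y: "y \<in> words N" for y
  proof -
    obtain z where z: "z \<in> neighborhood N {y}" "T z = c"
      using assms(1)[OF y] assms(2) by (metis bij_betw_imp_surj_on imageE)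
    then have "z \<in> words N" by (simp add: neighborhood_def)
    then show ?thesis using z y sym by (auto simp: neighborhood_def)
  qed
  ultimately show ?thesis
    by (auto simp: one_perfect_def neighborhood_def)
qed

section \<open>Vectors as functions vanishing from some index on\<close>

text \<open>Codewords stay lists, while columns, syndromes and labels are functions padded with
  zeros, so that linear combinations are pointwise and carry no length conditions.\<close>

definition coords :: "'a::zero list \<Rightarrow> nat \<Rightarrow> 'a" where
  "coords xs i = (if i < length xs then xs ! i else 0)"

definition vecs :: "nat \<Rightarrow> (nat \<Rightarrow> 'a::zero) set" where
  "vecs m = {u. \<forall>i\<ge>m. u i = 0}"

lemma bij_betw_coords: "bij_betw coords (words m) (vecs m)"
proof (rule bij_betwI[where g = "\<lambda>u. map u [0..<m]"])
  show "coords \<in> words m \<rightarrow> vecs m"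
    by (auto simp: coords_def words_def vecs_def)
  show "(\<lambda>u. map u [0..<m]) \<in> vecs m \<rightarrow> words m"
    by (auto simp: words_def)
  show "map (coords x) [0..<m] = x" if "x \<in> words m" for x :: "'a list"
    using that by (auto simp: words_def coords_def intro!: nth_equalityI)
  show "coords (map u [0..<m]) = u" if "u \<in> vecs m" for u :: "nat \<Rightarrow> 'a"
    using that by (auto simp: vecs_def coords_def fun_eq_iff)
qed

lemma coords_Cons_in_vecs: "x \<in> words s \<Longrightarrow> coords (b # x) \<in> vecs (s + 1)"
  by (auto simp: words_def vecs_def coords_def)

lemma coords_Cons_inj:
  assumes "x \<in> words s" "y \<in> words s" "coords (b # x) = coords (b' # y)"
  shows "b = b' \<and> x = y"
proof -
  have inj: "inj_on coords (words (s + 1))"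
    using bij_betw_coords by (auto simp: bij_betw_def)
  have "b # x = b' # y"
    by (rule inj_onD[OF inj assms(3)]) (use assms in \<open>simp_all add: words_def\<close>)
  then show ?thesis by simp
qed

lemma finite_words: "finite (words m :: 'a::finite list set)"
  using finite_lists_length_eq[of "UNIV :: 'a set" m] by (simp add: words_def)

lemma card_words: "card (words m :: 'a::finite list set) = CARD('a) ^ m"
  using card_lists_length_eq[of "UNIV :: 'a set" m] by (simp add: words_def)

lemma finite_vecs: "finite (vecs m :: (nat \<Rightarrow> 'a::{zero,finite}) set)"
  using bij_betw_coords bij_betw_finite finite_words by blast

lemma card_vecs: "card (vecs m :: (nat \<Rightarrow> 'a::{zero,finite}) set) = CARD('a) ^ m"
  using bij_betw_same_card[OF bij_betw_coords[where 'a = 'a and m = m]] by (simp add: card_words)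

section \<open>Points of the projective space and sets closed along a direction\<close>

definition unit_vec :: "nat \<Rightarrow> nat \<Rightarrow> 'a::zero_neq_one" where
  "unit_vec t i = of_bool (i = t)"

definition scaled :: "'a \<Rightarrow> (nat \<Rightarrow> 'a) \<Rightarrow> nat \<Rightarrow> 'a::times" where
  "scaled c u i = c * u i"

text \<open>One representative for each point of PG(m - 1, F): the multiple whose first nonzero
  coordinate is 1.\<close>

definition normalized :: "nat \<Rightarrow> (nat \<Rightarrow> 'f::field) set" where
  "normalized m = {u \<in> vecs m. \<exists>t<m. u t = 1 \<and> (\<forall>i<t. u i = 0)}"

lemma unit_vec_normalized: "t < m \<Longrightarrow> unit_vec t \<in> normalized m"
  by (auto simp: normalized_def vecs_def unit_vec_def)

lemma scaled_normalized_inj: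
  assumes "u \<in> normalized m" "u' \<in> normalized m" "c \<noteq> 0" "scaled c u = scaled c' u'"
  shows "c = c' \<and> u = u'"
proof -
  obtain t where t: "u t = 1" "\<forall>i<t. u i = 0" using assms by (auto simp: normalized_def)
  obtain t' where t': "u' t' = 1" "\<forall>i<t'. u' i = 0" using assms by (auto simp: normalized_def)
  have eq: "c * u i = c' * u' i" for i using assms(4) by (metis scaled_def)
  have c': "c' \<noteq> 0" using eq[of t] t assms(3) by auto
  have "t = t'"
    using eq[of t] eq[of t'] t t' c' assms(3) by (cases t t' rule: linorder_cases) auto
  then have "c = c'" using eq[of t] t t' by simp
  then show ?thesis using eq assms(3) by (auto simp: fun_eq_iff)
qed

lemma scaled_normalized_surj:
  assumes "u \<in> vecs m" "u \<noteq> (\<lambda>_. 0)"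
  obtains c w where "c \<noteq> 0" "w \<in> normalized m" "u = scaled c w"
proof -
  define t where "t = (LEAST i. u i \<noteq> 0)"
  have ex: "\<exists>i. u i \<noteq> 0" using assms(2) by auto
  have t: "u t \<noteq> 0" unfolding t_def using ex by (rule LeastI_ex)
  have z: "u i = 0" if "i < t" for i using that not_less_Least unfolding t_def by blast
  have "t < m" using t assms(1) by (auto simp: vecs_def not_le[symmetric])
  then have "scaled (inverse (u t)) u \<in> normalized m"
    using t z assms(1) by (auto simp: normalized_def vecs_def scaled_def)
  moreover have "u = scaled (u t) (scaled (inverse (u t)) u)"
    using t by (auto simp: scaled_def fun_eq_iff)
  ultimately show thesis using that t by blast
qed

text \<open>Every nonzero vector is a nonzero scalar times a normalized vector in exactly one
  way.\<close>

lemma card_normalized: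
  "(CARD('f) - 1) * card (normalized m :: (nat \<Rightarrow> 'f::{field,finite}) set) = CARD('f) ^ m - 1"
proof -
  have "bij_betw (\<lambda>(c, u). scaled c u) ((UNIV - {0 :: 'f}) \<times> normalized m) (vecs m - {\<lambda>_. 0})"
    unfolding bij_betw_def
  proof (intro conjI)
    show "inj_on (\<lambda>(c, u). scaled c u) ((UNIV - {0 :: 'f}) \<times> normalized m)"
      by (auto intro!: inj_onI dest: scaled_normalized_inj)
    have "scaled c u \<in> vecs m - {\<lambda>_. 0}" if cu: "c \<noteq> 0" "u \<in> normalized m" for c and u :: "nat \<Rightarrow> 'f"
    proof -
      obtain t where "u t = 1" using cu(2) by (auto simp: normalized_def)
      then have "scaled c u t \<noteq> 0" using cu(1) by (simp add: scaled_def)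
      moreover have "scaled c u \<in> vecs m"
        using cu(2) by (auto simp: normalized_def vecs_def scaled_def)
      ultimately show ?thesis by auto
    qed
    moreover have "u \<in> (\<lambda>(c, u). scaled c u) ` ((UNIV - {0 :: 'f}) \<times> normalized m)"
      if u: "u \<in> vecs m - {\<lambda>_. 0}" for u
    proof -
      obtain c w where "c \<noteq> 0" "w \<in> normalized m" "u = scaled c w"
        using u scaled_normalized_surj[of u m] by auto
      then show ?thesis by (intro image_eqI[of _ _ "(c, w)"]) auto
    qed
    ultimately show "(\<lambda>(c, u). scaled c u) ` ((UNIV - {0 :: 'f}) \<times> normalized m) = vecs m - {\<lambda>_. 0}"
      by auto
  qed
  then have "card ((UNIV - {0 :: 'f}) \<times> (normalized m :: (nat \<Rightarrow> 'f) set)) = card (vecs m - {\<lambda>_. 0 :: 'f})"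
    by (rule bij_betw_same_card)
  moreover have "(\<lambda>_. 0 :: 'f) \<in> vecs m" by (simp add: vecs_def)
  ultimately show ?thesis
    by (simp add: card_cartesian_product card_Diff_subset finite_vecs card_vecs)
qed

text \<open>The unit vectors are distinct normalized vectors, and there are \<open>n\<close>
  normalized vectors in all, so the numbering of the unit vectors extends to an enumeration of all
  points.\<close>

lemma exists_projective_enumeration:
  assumes "n = (CARD('f) ^ (s + 1) - 1) div (CARD('f) - 1)"
  obtains a :: "nat \<Rightarrow> nat \<Rightarrow> 'f::{field,finite}"
  where "bij_betw a {..<n} (normalized (s + 1))" "\<And>t. t \<le> s \<Longrightarrow> a t = unit_vec t" "s < n"
proof -
  let ?R = "normalized (s + 1) :: (nat \<Rightarrow> 'f) set"
  \<comment> \<open>This makes the factor \<open>CARD('f) - 1\<close> nonzero, so that it can be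
    cancelled in the count of points.\<close>
  have "CARD('f) \<ge> 2"
    using card_mono[of "UNIV :: 'f set" "{0, 1}"] by simp
  then have card: "card ?R = n"
    using card_normalized[where 'f = 'f and m = "s + 1"] assms
    by (metis One_nat_def diff_is_0_eq nonzero_mult_div_cancel_left not_less_eq_eq numeral_2_eq_2)
  have inj: "inj_on (unit_vec :: nat \<Rightarrow> nat \<Rightarrow> 'f) {..s}"
    by (auto simp: inj_on_def unit_vec_def fun_eq_iff of_bool_def split: if_splits)
  have sub: "(unit_vec :: nat \<Rightarrow> nat \<Rightarrow> 'f) ` {..s} \<subseteq> ?R"
    using unit_vec_normalized by (metis Suc_eq_plus1 atMost_iff image_subsetI less_Suc_eq_le)
  have fin: "finite ?R"
    using finite_vecs by (rule finite_subset[rotated]) (auto simp: normalized_def)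
  have "s < n"
    using card_mono[OF fin sub] card card_image[OF inj] by simp
  then have "{..s} \<subseteq> {..<n}" by auto
  with inj_on_extends_to_bij_betw[OF finite_lessThan fin _ _ inj sub, of n] card
  obtain a where "bij_betw a {..<n} ?R" "\<And>t. t \<in> {..s} \<Longrightarrow> a t = unit_vec t"
    by (metis card_lessThan)
  then show thesis using that \<open>s < n\<close> by simp
qed

text \<open>The nonempty sets of this kind are the unions of subspaces of dimension at most 2
  containing \<open>d\<close>.\<close>

definition line_closed :: "(nat \<Rightarrow> 'f) \<Rightarrow> (nat \<Rightarrow> 'f::field) set \<Rightarrow> bool" where
  "line_closed d W \<longleftrightarrow> (\<forall>u\<in>W. \<forall>\<alpha> \<beta>. (\<lambda>i. \<alpha> * u i + \<beta> * d i) \<in> W)"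

lemma line_closedD: "line_closed d W \<Longrightarrow> u \<in> W \<Longrightarrow> (\<lambda>i. \<alpha> * u i + \<beta> * d i) \<in> W"
  by (simp add: line_closed_def)

lemma line_closed_scaled_iff:
  assumes "line_closed d W" "c \<noteq> 0"
  shows "scaled c u \<in> W \<longleftrightarrow> u \<in> W"
proof
  show "u \<in> W" if "scaled c u \<in> W"
    using line_closedD[OF assms(1) that, of "inverse c" 0] assms(2)
    by (simp add: scaled_def mult.assoc[symmetric])
  show "scaled c u \<in> W" if "u \<in> W"
    using line_closedD[OF assms(1) that, of c 0] by (simp add: scaled_def[abs_def])
qed

text \<open>Membership depends only on the class modulo \<open>d\<close>. Hence two corrections that
  differ by a multiple of \<open>d\<close> lie in the same line-closed sets.\<close>

lemma line_closed_add_iff: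
  assumes "line_closed d W"
  shows "(\<lambda>i. u i + \<beta> * d i) \<in> W \<longleftrightarrow> u \<in> W"
proof
  show "u \<in> W" if "(\<lambda>i. u i + \<beta> * d i) \<in> W"
    using line_closedD[OF assms that, of 1 "- \<beta>"] by simp
  show "(\<lambda>i. u i + \<beta> * d i) \<in> W" if "u \<in> W"
    using line_closedD[OF assms that, of 1 \<beta>] by simp
qed

section \<open>Partial syndromes, components and the switched labelling\<close>

text \<open>The cells enter only as the fibres of \<open>f\<close>: the word \<open>f x\<close>
  names the cell of \<open>x\<close>, and \<open>f_dist\<close> expresses that the cells are
  1-codes.\<close>

locale switching =
  fixes s n :: nat and a :: "nat \<Rightarrow> nat \<Rightarrow> 'f::{field,finite}"
    and f :: "'f list \<Rightarrow> 'f list"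
  assumes columns: "bij_betw a {..<n} (normalized (s + 1))"
    and columns_unit: "\<And>t. t \<le> s \<Longrightarrow> a t = unit_vec t"
    and s_less_n: "s < n"
    and f_words: "\<And>x. x \<in> words s \<Longrightarrow> f x \<in> words s"
    and f_dist: "\<And>x y. \<lbrakk>x \<in> words s; y \<in> words s; f x = f y; x \<noteq> y\<rbrakk> \<Longrightarrow> hamming_dist x y \<ge> 3"
begin

text \<open>The part of the syndrome contributed by the columns in \<open>W\<close>. Taken modulo
  \<open>d\<close>, for all line-closed \<open>W\<close>, these parts are the invariants behind
  \<open>equivalent\<close>.\<close>

definition syndrome_in :: "(nat \<Rightarrow> 'f) set \<Rightarrow> 'f list \<Rightarrow> nat \<Rightarrow> 'f" where
  "syndrome_in W v i = (\<Sum>p | p < n \<and> a p \<in> W. v ! p * a p i)"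

definition syndrome :: "'f list \<Rightarrow> nat \<Rightarrow> 'f" where
  "syndrome = syndrome_in UNIV"

text \<open>The usual components in direction \<open>d\<close> are defined by chains of codewords of weight 3; the
  condition below is the dual description, by invariants.\<close>

definition equivalent :: "(nat \<Rightarrow> 'f) \<Rightarrow> 'f list \<Rightarrow> 'f list \<Rightarrow> bool" where
  "equivalent d v w \<longleftrightarrow>
     (\<forall>W. line_closed d W \<longrightarrow> (\<exists>c. \<forall>i. syndrome_in W v i - syndrome_in W w i = c * d i))"

definition embed :: "'f list \<Rightarrow> 'f list" where
  "embed x = 1 # x @ replicate (n - s - 1) 0"

definition direction :: "'f list \<Rightarrow> nat \<Rightarrow> 'f" where
  "direction x i = coords (1 # x) i - coords (0 # f x) i"

definition component :: "'f list \<Rightarrow> 'f list set" where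
  "component x = {v. equivalent (direction x) v (embed x) \<and> syndrome v = coords (1 # x)}"

definition shifted_component :: "'f list \<Rightarrow> 'f list set" where
  "shifted_component x =
     {v. equivalent (direction x) v (embed x) \<and> syndrome v = coords (0 # f x)}"

text \<open>The syndrome after all switchings: the two labels belonging to \<open>x\<close> are
  exchanged on its two components. The choices are unambiguous because components of different
  \<open>x\<close> turn out to be disjoint.\<close>

definition colour :: "'f list \<Rightarrow> nat \<Rightarrow> 'f" where
  "colour v =
     (if \<exists>x\<in>words s. v \<in> component x
      then coords (0 # f (SOME x. x \<in> words s \<and> v \<in> component x))
      else if \<exists>x\<in>words s. v \<in> shifted_component x
      then coords (1 # (SOME x. x \<in> words s \<and> v \<in> shifted_component x))
      else syndrome v)"

section \<open>Columns and the syndrome on balls\<close>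

lemma column_in_normalized: "p < n \<Longrightarrow> a p \<in> normalized (s + 1)"
  using columns by (auto simp: bij_betw_def)

lemma column_in_vecs: "p < n \<Longrightarrow> a p \<in> vecs (s + 1)"
  using column_in_normalized by (auto simp: normalized_def)

lemma scaled_column_inj:
  assumes "p < n" "p' < n" "c \<noteq> 0" "scaled c (a p) = scaled c' (a p')"
  shows "c = c' \<and> p = p'"
proof -
  have "c = c' \<and> a p = a p'"
    by (rule scaled_normalized_inj[OF column_in_normalized column_in_normalized]) (fact assms)+
  then show ?thesis
    using bij_betw_imp_inj_on[OF columns] assms(1,2) by (auto dest: inj_onD)
qed

lemma scaled_column_surj:
  assumes "u \<in> vecs (s + 1)"
  obtains c p where "p < n" "u = scaled c (a p)"
proof (cases "u = (\<lambda>_. 0)")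
  case True
  \<comment> \<open>The zero vector is no multiple of a point by a nonzero scalar; with scalar 0 any
    column serves, and column 0 exists since \<open>s < n\<close>.\<close>
  then have "u = scaled 0 (a 0)" by (simp add: scaled_def[abs_def])
  then show thesis using that s_less_n by auto
next
  case False
  then obtain c w where w: "w \<in> normalized (s + 1)" "u = scaled c w"
    using scaled_normalized_surj assms by blast
  then obtain p where "p < n" "w = a p"
    using columns by (metis bij_betw_imp_surj_on imageE lessThan_iff)
  then show thesis using that w by blast
qed

lemma syndrome_in_update:
  assumes "v \<in> words n" "p < n"
  shows "syndrome_in W (v[p := v ! p + c]) i
    = syndrome_in W v i + (if a p \<in> W then scaled c (a p) i else 0)"
proof -
  let ?K = "{r. r < n \<and> a r \<in> W}"
  have "v[p := v ! p + c] ! r * a r i = v ! r * a r i + (if r = p then c * a p i else 0)"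
    if "r < n" for r
    using that assms by (cases "r = p") (simp_all add: words_def distrib_right)
  then have "syndrome_in W (v[p := v ! p + c]) i
      = (\<Sum>r\<in>?K. v ! r * a r i + (if r = p then c * a p i else 0))"
    unfolding syndrome_in_def by (intro sum.cong refl) blast
  also have "\<dots> = syndrome_in W v i + (\<Sum>r\<in>?K. if r = p then c * a p i else 0)"
    unfolding syndrome_in_def by (rule sum.distrib)
  also have "(\<Sum>r\<in>?K. if r = p then c * a p i else 0) = (if p \<in> ?K then c * a p i else 0)"
    by (rule sum.delta) simp
  finally show ?thesis
    using assms(2) by (simp add: scaled_def)
qed

lemma syndrome_update:
  assumes "v \<in> words n" "p < n"
  shows "syndrome (v[p := v ! p + c]) i = syndrome v i + scaled c (a p) i"
  using syndrome_in_update[OF assms] by (simp add: syndrome_def)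

lemma syndrome_in_vecs: "syndrome v \<in> vecs (s + 1)"
  using column_in_vecs by (auto simp: vecs_def syndrome_def syndrome_in_def)

text \<open>Two neighbours with equal syndromes change it by equal multiples of columns, and
  different columns are not proportional.\<close>

lemma syndrome_inj_on_neighborhood:
  assumes v: "v \<in> words n"
  shows "inj_on syndrome (neighborhood n {v})"
proof (rule inj_onI)
  fix z z' assume "z \<in> neighborhood n {v}" "z' \<in> neighborhood n {v}"
    and eq: "syndrome z = syndrome z'"
  then obtain p c p' c' where z: "p < n" "z = v[p := v ! p + c]" "p' < n" "z' = v[p' := v ! p' + c']"
    using neighborhood_singleton_eq_updates[OF v] s_less_n by auto
  have "scaled c (a p) = scaled c' (a p')"
  proof
    show "scaled c (a p) i = scaled c' (a p') i" for i
      using fun_cong[OF eq, of i] syndrome_update[OF v] z by simp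
  qed
  \<comment> \<open>In the second case the positions may differ, but both updates leave
    \<open>v\<close> unchanged.\<close>
  then have "c = c' \<and> p = p' \<or> c = 0 \<and> c' = 0"
    using scaled_column_inj[of p p' c c'] scaled_column_inj[of p' p c' c] z by auto
  then show "z = z'" using z by auto
qed

lemma card_neighborhood_le:
  fixes v :: "'f list"
  assumes "v \<in> words n"
  shows "card (neighborhood n {v}) \<le> card (vecs (s + 1) :: (nat \<Rightarrow> 'f) set)"
  using syndrome_inj_on_neighborhood[OF assms] syndrome_in_vecs finite_vecs
  by (intro card_inj_on_le[of syndrome]) auto

text \<open>The required correction \<open>u - syndrome v\<close> is a multiple of some column, so
  changing that one entry suffices. The last conclusion speaks of the correction instead of the
  column, which allows neighbours changed at different positions to be compared.\<close>

lemma neighbor_with_syndrome: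
  assumes v: "v \<in> words n" and u: "u \<in> vecs (s + 1)"
  obtains z where "z \<in> neighborhood n {v}" "syndrome z = u"
    "\<And>d W i. line_closed d W \<Longrightarrow> syndrome_in W z i = syndrome_in W v i
      + (if (\<lambda>i. u i - syndrome v i) \<in> W then u i - syndrome v i else 0)"
proof -
  define w where "w = (\<lambda>i. u i - syndrome v i)"
  have "w \<in> vecs (s + 1)" using u syndrome_in_vecs[of v] by (simp add: vecs_def w_def)
  then obtain c p where p: "p < n" "w = scaled c (a p)"
    by (rule scaled_column_surj)
  let ?z = "v[p := v ! p + c]"
  have "?z \<in> neighborhood n {v}"
    using neighborhood_singleton_eq_updates[OF v] p(1) s_less_n by blast
  moreover have "syndrome ?z = u"
  proof
    fix i
    have "syndrome ?z i = syndrome v i + w i" unfolding p(2) by (rule syndrome_update[OF v p(1)])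
    then show "syndrome ?z i = u i" by (simp add: w_def)
  qed
  moreover have "syndrome_in W ?z i = syndrome_in W v i + (if w \<in> W then w i else 0)"
    if W: "line_closed d W" for d W i
  \<comment> \<open>For \<open>c = 0\<close> the correction does not determine the column, but both
    possible contributions vanish. Otherwise \<open>w\<close> and \<open>a p\<close> are
    proportional and lie in the same line-closed sets.\<close>
  proof (cases "c = 0")
    case True
    then have "w i = 0" by (simp add: p(2) scaled_def)
    then show ?thesis
      using syndrome_in_update[OF v p(1), of W c i] unfolding p(2) by simp
  next
    case False
    then have "w \<in> W \<longleftrightarrow> a p \<in> W" unfolding p(2) by (rule line_closed_scaled_iff[OF W])
    then show ?thesis
      using syndrome_in_update[OF v p(1), of W c i] p(2) by simp
  qed
  ultimately show thesis using that unfolding w_def by blast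
qed

lemma embed_in_words: "x \<in> words s \<Longrightarrow> embed x \<in> words n"
  using s_less_n by (simp add: embed_def words_def)

text \<open>The embedded word is supported on the positions whose columns are unit vectors, so
  coordinate \<open>i\<close> can only come from position \<open>i\<close>; for \<open>i > s\<close>
  both sides are 0.\<close>

lemma syndrome_in_embed:
  assumes "x \<in> words s"
  shows "syndrome_in W (embed x) i = (if unit_vec i \<in> W then coords (1 # x) i else 0)"
proof -
  have "embed x ! p * a p i = (if p = i then coords (1 # x) i else 0)" if "p < n" for p
  proof (cases "p \<le> s")
    case True
    then have "embed x ! p = coords (1 # x) p"
      using assms by (cases p) (auto simp: embed_def coords_def words_def nth_append)
    then show ?thesis using columns_unit[OF True] by (simp add: unit_vec_def)
  next
    case False
    then have "embed x ! p = 0"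
      using assms that by (cases p) (auto simp: embed_def words_def nth_append)
    then show ?thesis using assms False by (simp add: coords_def words_def)
  qed
  then have "syndrome_in W (embed x) i
      = (\<Sum>p | p < n \<and> a p \<in> W. if p = i then coords (1 # x) i else 0)"
    unfolding syndrome_in_def by (intro sum.cong) auto
  also have "\<dots> = (if i < n \<and> a i \<in> W then coords (1 # x) i else 0)"
    by simp
  also have "\<dots> = (if unit_vec i \<in> W then coords (1 # x) i else 0)"
  proof (cases "i \<le> s")
    case True
    then show ?thesis using s_less_n columns_unit by simp
  next
    case False
    then show ?thesis using assms by (simp add: coords_def words_def)
  qed
  finally show ?thesis .
qed

lemma syndrome_embed: "x \<in> words s \<Longrightarrow> syndrome (embed x) = coords (1 # x)"
  by (simp add: syndrome_def syndrome_in_embed fun_eq_iff)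

section \<open>Equivalence along a direction\<close>

lemma equivalent_refl: "equivalent d v v"
  unfolding equivalent_def by (auto intro!: exI[of _ 0])

lemma equivalent_trans:
  assumes "equivalent d u v" "equivalent d v w"
  shows "equivalent d u w"
  unfolding equivalent_def
proof (intro allI impI)
  fix W assume "line_closed d W"
  then obtain c c' where c: "\<And>i. c * d i = syndrome_in W u i - syndrome_in W v i"
    and c': "\<And>i. c' * d i = syndrome_in W v i - syndrome_in W w i"
    using assms unfolding equivalent_def by metis
  have "\<forall>i. syndrome_in W u i - syndrome_in W w i = (c + c') * d i"
    by (simp add: distrib_right c c')
  then show "\<exists>c. \<forall>i. syndrome_in W u i - syndrome_in W w i = c * d i" by blast
qed

text \<open>The corrections leading from \<open>v\<close> to the two syndromes differ by
  \<open>b\<close> times \<open>d\<close>, so each line-closed set contains both or neither, and the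
  partial syndromes differ by \<open>b\<close> times \<open>d\<close> or by 0. This is why a ball
  that meets one of the two components of \<open>x\<close> also meets the other.\<close>

lemma equivalent_neighbors:
  assumes v: "v \<in> words n" and u: "u \<in> vecs (s + 1)" and u': "u' \<in> vecs (s + 1)"
    and diff: "\<And>i. u' i = u i + b * d i"
  obtains z z' where "z \<in> neighborhood n {v}" "z' \<in> neighborhood n {v}"
    "syndrome z = u" "syndrome z' = u'" "equivalent d z' z"
proof -
  obtain z where z: "z \<in> neighborhood n {v}" "syndrome z = u"
    "\<And>d W i. line_closed d W \<Longrightarrow> syndrome_in W z i = syndrome_in W v i
      + (if (\<lambda>i. u i - syndrome v i) \<in> W then u i - syndrome v i else 0)"
    by (rule neighbor_with_syndrome[OF v u]) blast
  obtain z' where z': "z' \<in> neighborhood n {v}" "syndrome z' = u'"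
    "\<And>d W i. line_closed d W \<Longrightarrow> syndrome_in W z' i = syndrome_in W v i
      + (if (\<lambda>i. u' i - syndrome v i) \<in> W then u' i - syndrome v i else 0)"
    by (rule neighbor_with_syndrome[OF v u']) blast
  have "\<exists>c. \<forall>i. syndrome_in W z' i - syndrome_in W z i = c * d i" if W: "line_closed d W" for W
  proof -
    have "(\<lambda>i. u' i - syndrome v i) \<in> W \<longleftrightarrow> (\<lambda>i. u i - syndrome v i) \<in> W"
      using line_closed_add_iff[OF W, of "\<lambda>i. u i - syndrome v i" b] diff
      by (simp add: algebra_simps)
    then show ?thesis
      using diff z(3)[OF W] z'(3)[OF W]
      by (intro exI[of _ "if (\<lambda>i. u i - syndrome v i) \<in> W then b else 0"]) auto
  qed
  then have "equivalent d z' z" unfolding equivalent_def by blast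
  then show thesis using that z z' by blast
qed

section \<open>Disjointness of the components\<close>

text \<open>The label \<open>(0, f x)\<close> reveals only the cell of \<open>x\<close>, so here the
  distance condition must do the work. A common word would relate the partial syndromes of both
  embedded words over any \<open>W\<close> closed along both directions; the positions where
  \<open>x\<close> and \<open>y\<close> differ yield a \<open>W\<close> for which this is
  impossible.\<close>

lemma shifted_component_unique:
  assumes x: "x \<in> words s" and y: "y \<in> words s"
    and vx: "v \<in> shifted_component x" and vy: "v \<in> shifted_component y"
  shows "x = y"
proof (rule ccontr)
  assume "x \<noteq> y"
  have "f x = f y"
    using vx vy coords_Cons_inj[OF f_words[OF x] f_words[OF y]]
    by (auto simp: shifted_component_def)
  then have "card {i. i < length x \<and> x ! i \<noteq> y ! i} \<ge> 3"
    using f_dist x y \<open>x \<noteq> y\<close> by (simp add: hamming_dist_def)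
  \<comment> \<open>Of the three positions, \<open>t\<close> will have its unit vector in
    \<open>W\<close>, \<open>r\<close> will have it outside, and \<open>l\<close> is the witness
    that it is outside. Coordinates are shifted by one because coordinate 0 holds the prefixed
    entry.\<close>
  then obtain D where D: "D \<subseteq> {i. i < length x \<and> x ! i \<noteq> y ! i}" "card D = 3"
    by (rule obtain_subset_with_card_n)
  then obtain t r l where "D = {t, r, l}" "t \<noteq> r" "r \<noteq> l" "t \<noteq> l"
    by (auto simp: card_3_iff)
  with D x have t: "t < s" "x ! t \<noteq> y ! t" and r: "r < s" "x ! r \<noteq> y ! r"
    and l: "l < s" "x ! l \<noteq> y ! l" and distinct: "t \<noteq> r" "r \<noteq> l" "t \<noteq> l"
    by (auto simp: words_def)
  define e where "e i = coords (0 # x) i - coords (0 # y) i" for i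
  let ?dx = "direction x" and ?dy = "direction y"
  have dx_dy: "?dx i - ?dy i = e i" for i
    using \<open>f x = f y\<close> by (cases i) (auto simp: direction_def e_def coords_def)
  have dx0: "?dx 0 = 1" by (simp add: direction_def coords_def)
  have dy0: "?dy 0 = 1" by (simp add: direction_def coords_def)
  have e0: "e 0 = 0" by (simp add: e_def coords_def)
  have e_Suc: "e (Suc i) = x ! i - y ! i" if "i < s" for i
    using that x y by (simp add: e_def coords_def words_def)
  text \<open>The span of both directions and the unit vector at one position where \<open>x\<close>, \<open>y\<close> differ. Being
    3-dimensional, it cannot contain the unit vectors of all three such positions, whereas
    equivalence to both embedded words would force that.\<close>
  define W where "W = {\<lambda>i. \<alpha> * ?dx i + \<beta> * e i + \<gamma> * unit_vec (Suc t) i | \<alpha> \<beta> \<gamma>. True}"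
  have Wx: "line_closed ?dx W"
    unfolding line_closed_def
  proof (intro ballI allI)
    fix u \<alpha> \<beta> assume "u \<in> W"
    then obtain \<alpha>' \<beta>' \<gamma>' where "u = (\<lambda>i. \<alpha>' * ?dx i + \<beta>' * e i + \<gamma>' * unit_vec (Suc t) i)"
      unfolding W_def by blast
    then have "(\<lambda>i. \<alpha> * u i + \<beta> * ?dx i)
        = (\<lambda>i. (\<alpha> * \<alpha>' + \<beta>) * ?dx i + (\<alpha> * \<beta>') * e i + (\<alpha> * \<gamma>') * unit_vec (Suc t) i)"
      by (simp add: algebra_simps)
    then show "(\<lambda>i. \<alpha> * u i + \<beta> * ?dx i) \<in> W" unfolding W_def by blast
  qed
  have Wy: "line_closed ?dy W"
    unfolding line_closed_def
  proof (intro ballI allI)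
    fix u \<alpha> \<beta> assume "u \<in> W"
    then obtain \<alpha>' \<beta>' \<gamma>' where u: "u = (\<lambda>i. \<alpha>' * ?dx i + \<beta>' * e i + \<gamma>' * unit_vec (Suc t) i)"
      unfolding W_def by blast
    have dy: "?dy i = ?dx i - e i" for i by (simp add: dx_dy[symmetric])
    have "(\<lambda>i. \<alpha> * u i + \<beta> * ?dy i)
        = (\<lambda>i. (\<alpha> * \<alpha>' + \<beta>) * ?dx i + (\<alpha> * \<beta>' - \<beta>) * e i + (\<alpha> * \<gamma>') * unit_vec (Suc t) i)"
      unfolding u dy by (simp add: algebra_simps)
    then show "(\<lambda>i. \<alpha> * u i + \<beta> * ?dy i) \<in> W" unfolding W_def by blast
  qed
  have t_W: "unit_vec (Suc t) \<in> W"
  proof -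
    have "unit_vec (Suc t) = (\<lambda>i. 0 * ?dx i + 0 * e i + 1 * unit_vec (Suc t) i)" by simp
    then show ?thesis unfolding W_def by blast
  qed
  have r_W: "unit_vec (Suc r) \<notin> W"
  proof
    assume "unit_vec (Suc r) \<in> W"
    then obtain \<alpha> \<beta> \<gamma> where
      "unit_vec (Suc r) = (\<lambda>i. \<alpha> * ?dx i + \<beta> * e i + \<gamma> * unit_vec (Suc t) i)"
      unfolding W_def by blast
    then have eq: "unit_vec (Suc r) i = \<alpha> * ?dx i + \<beta> * e i + \<gamma> * unit_vec (Suc t) i" for i
      by metis
    \<comment> \<open>Coordinate 0 removes the direction, coordinate \<open>Suc r\<close> forces
      \<open>e\<close> to occur, and coordinate \<open>Suc l\<close> forbids it.\<close>
    have "\<alpha> = 0" using eq[of 0] dx0 e0 by (simp add: unit_vec_def)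
    then have "\<beta> \<noteq> 0" using eq[of "Suc r"] distinct by (auto simp: unit_vec_def)
    moreover have "\<beta> * e (Suc l) = 0"
      using eq[of "Suc l"] \<open>\<alpha> = 0\<close> distinct by (simp add: unit_vec_def)
    ultimately show False using e_Suc l by simp
  qed
  obtain cx where cx: "\<And>i. syndrome_in W v i - syndrome_in W (embed x) i = cx * ?dx i"
    using vx Wx unfolding shifted_component_def equivalent_def by blast
  obtain cy where cy: "\<And>i. syndrome_in W v i - syndrome_in W (embed y) i = cy * ?dy i"
    using vy Wy unfolding shifted_component_def equivalent_def by blast
  have diff: "syndrome_in W (embed x) i - syndrome_in W (embed y) i = cy * ?dy i - cx * ?dx i" for i
    using cx[of i] cy[of i] by (simp add: algebra_simps)
  have embed_diff: "syndrome_in W (embed x) (Suc i) - syndrome_in W (embed y) (Suc i)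
      = (if unit_vec (Suc i) \<in> W then x ! i - y ! i else 0)" if "i < s" for i
    using that x y by (simp add: syndrome_in_embed coords_def words_def)
  have embed_diff_0: "syndrome_in W (embed x) 0 - syndrome_in W (embed y) 0 = 0"
    using x y by (simp add: syndrome_in_embed coords_def)
  \<comment> \<open>Both embedded words begin with 1 and both directions have coordinate 0 equal to
    1, so the two multiples coincide and only a multiple of \<open>e\<close> remains.\<close>
  have "cx = cy" using diff[of 0] embed_diff_0 dx0 dy0 by simp
  then have diff': "syndrome_in W (embed x) i - syndrome_in W (embed y) i = - cx * e i" for i
    using diff[of i] by (simp add: dx_dy[symmetric] right_diff_distrib)
  \<comment> \<open>The difference at \<open>t\<close> is visible over \<open>W\<close> and the one
    at \<open>r\<close> is not, yet both are given by the same multiple of \<open>e\<close>, which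
    is nonzero at both.\<close>
  have "cx \<noteq> 0"
    using diff'[of "Suc t"] embed_diff[of t] t t_W by auto
  moreover have "cx * e (Suc r) = 0"
    using diff'[of "Suc r"] embed_diff[of r] r r_W by auto
  ultimately show False using e_Suc r by simp
qed

lemma component_unique:
  assumes "x \<in> words s" "y \<in> words s" "v \<in> component x" "v \<in> component y"
  shows "x = y"
  using coords_Cons_inj[OF assms(1,2), of 1 1] assms(3,4) by (simp add: component_def)

lemma component_shifted_component_disjoint:
  assumes "x \<in> words s" "y \<in> words s" "v \<in> component x" "v \<in> shifted_component y"
  shows False
  using coords_Cons_inj[OF assms(1) f_words[OF assms(2)], of 1 0] assms(3,4)
  by (simp add: component_def shifted_component_def)

section \<open>The switched labelling is bijective on balls\<close>

lemma colour_component: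
  assumes "x \<in> words s" "v \<in> component x"
  shows "colour v = coords (0 # f x)"
proof -
  have "(SOME y. y \<in> words s \<and> v \<in> component y) = x"
    using assms component_unique by (intro some_equality) auto
  then show ?thesis unfolding colour_def using assms by auto
qed

lemma colour_shifted_component:
  assumes "x \<in> words s" "v \<in> shifted_component x"
  shows "colour v = coords (1 # x)"
proof -
  have "(SOME y. y \<in> words s \<and> v \<in> shifted_component y) = x"
    using assms shifted_component_unique by (intro some_equality) auto
  moreover have "\<not> (\<exists>y\<in>words s. v \<in> component y)"
    using assms component_shifted_component_disjoint by blast
  ultimately show ?thesis unfolding colour_def using assms by auto
qed

lemma colour_in_vecs: "colour v \<in> vecs (s + 1)"
proof (cases "\<exists>x\<in>words s. v \<in> component x \<or> v \<in> shifted_component x")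
  case True
  then obtain x where "x \<in> words s" "v \<in> component x \<or> v \<in> shifted_component x"
    by blast
  then show ?thesis
    using colour_component colour_shifted_component coords_Cons_in_vecs f_words by metis
next
  case False
  then have "colour v = syndrome v" by (auto simp: colour_def)
  then show ?thesis by (simp only: syndrome_in_vecs)
qed

lemma embed_in_component: "x \<in> words s \<Longrightarrow> embed x \<in> component x"
  by (simp add: component_def equivalent_refl syndrome_embed)

lemma colour_embed: "x \<in> words s \<Longrightarrow> colour (embed x) = coords (0 # f x)"
  by (rule colour_component) (auto intro: embed_in_component)

text \<open>The neighbour \<open>z\<close> with syndrome \<open>u\<close> has colour
  \<open>u\<close> unless it was switched. If it was, the neighbour carrying the exchanged syndrome
  lies in the partner component, and that neighbour has received the colour
  \<open>u\<close>.\<close>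

lemma neighbor_with_colour:
  assumes v: "v \<in> words n" and u: "u \<in> vecs (s + 1)"
  shows "\<exists>z\<in>neighborhood n {v}. colour z = u"
proof -
  obtain z where z: "z \<in> neighborhood n {v}" "syndrome z = u"
    by (rule neighbor_with_syndrome[OF v u]) blast
  consider x where "x \<in> words s" "z \<in> component x"
    | x where "x \<in> words s" "z \<in> shifted_component x"
    | "\<forall>x\<in>words s. z \<notin> component x \<and> z \<notin> shifted_component x"
    by blast
  then show ?thesis
  proof cases
    case 1
    then have ux: "u = coords (1 # x)" using z by (simp add: component_def)
    have "coords (0 # f x) \<in> vecs (s + 1)" using 1 f_words coords_Cons_in_vecs by blast
    moreover have "coords (0 # f x) i = u i + - 1 * direction x i" for i
      by (simp add: ux direction_def)
    ultimately obtain y z' where y: "y \<in> neighborhood n {v}" "z' \<in> neighborhood n {v}"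
      "syndrome y = u" "syndrome z' = coords (0 # f x)" "equivalent (direction x) z' y"
      using equivalent_neighbors[OF v u, of "coords (0 # f x)" "- 1" "direction x"] by blast
    \<comment> \<open>The ball contains only one word of syndrome \<open>u\<close>, so the
      equivalence obtained for \<open>y\<close> concerns \<open>z\<close> itself.\<close>
    then have "y = z" using inj_onD[OF syndrome_inj_on_neighborhood[OF v]] z by auto
    then have "z' \<in> shifted_component x"
      using 1 y equivalent_trans by (auto simp: component_def shifted_component_def)
    then have "colour z' = u" unfolding ux by (rule colour_shifted_component[OF 1(1)])
    then show ?thesis using y(2) by blast
  next
    case 2
    then have ux: "u = coords (0 # f x)" using z by (simp add: shifted_component_def)
    have "coords (1 # x) \<in> vecs (s + 1)" using 2 coords_Cons_in_vecs by blast
    moreover have "coords (1 # x) i = u i + 1 * direction x i" for i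
      by (simp add: ux direction_def)
    ultimately obtain y z' where y: "y \<in> neighborhood n {v}" "z' \<in> neighborhood n {v}"
      "syndrome y = u" "syndrome z' = coords (1 # x)" "equivalent (direction x) z' y"
      using equivalent_neighbors[OF v u, of "coords (1 # x)" 1 "direction x"] by blast
    then have "y = z" using inj_onD[OF syndrome_inj_on_neighborhood[OF v]] z by auto
    then have "z' \<in> component x"
      using 2 y equivalent_trans by (auto simp: component_def shifted_component_def)
    then have "colour z' = u" unfolding ux by (rule colour_component[OF 2(1)])
    then show ?thesis using y(2) by blast
  next
    case 3
    then have "colour z = u" using z by (auto simp: colour_def)
    then show ?thesis using z by blast
  qed
qed

text \<open>The colouring maps the ball onto a set at least as large as the ball, so it is also
  injective.\<close>

lemma colour_bij_betw:
  assumes v: "v \<in> words n"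
  shows "bij_betw colour (neighborhood n {v}) (vecs (s + 1))"
proof -
  have fin: "finite (neighborhood n {v})"
    using finite_words[of n] by (rule finite_subset[rotated]) (auto simp: neighborhood_def)
  have onto: "colour ` neighborhood n {v} = vecs (s + 1)"
  proof (intro equalityI subsetI)
    show "u \<in> vecs (s + 1)" if "u \<in> colour ` neighborhood n {v}" for u
      using that colour_in_vecs by blast
    show "u \<in> colour ` neighborhood n {v}" if "u \<in> vecs (s + 1)" for u
      using neighbor_with_colour[OF v that] by blast
  qed
  have "card (colour ` neighborhood n {v}) = card (neighborhood n {v})"
    using card_neighborhood_le[OF v] card_image_le[OF fin, of colour] onto by simp
  with fin have "inj_on colour (neighborhood n {v})" by (rule eq_card_imp_inj_on)
  then show ?thesis using onto by (simp add: bij_betw_def)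
qed

end

section \<open>Assembling the partition\<close>

theorem theorem2:
  fixes q s n k :: nat
    and C :: "nat \<Rightarrow> 'f::{field,finite} list set"
  assumes "primepow q"
    and "CARD('f) = q"
    and "s \<ge> 1"
    and "n = (q ^ (s + 1) - 1) div (q - 1)"
    and "indexed_partition (words s) k C"
    and "\<forall>j\<in>{1..k}. one_code s (C j)"
  shows "k \<le> q ^ (s + 1) \<and>
    (\<exists>P :: nat \<Rightarrow> 'f list set.
       indexed_partition (words n) (q ^ (s + 1)) P \<and>
       (\<forall>i\<in>{1..q ^ (s + 1)}. one_perfect n (P i)) \<and>
       (\<forall>j\<in>{1..k}. C j = {x \<in> words s. 1 # x @ replicate (n - s - 1) 0 \<in> P j}))"
proof -
  let ?Q = "q ^ (s + 1)"
  let ?V = "vecs (s + 1) :: (nat \<Rightarrow> 'f) set"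
  have inj_C: "inj_on C {1..k}" and part: "partition_on (words s) (C ` {1..k})"
    using assms(5) by (auto simp: indexed_partition_def)
  have C_words: "C j \<subseteq> words s" if "j \<in> {1..k}" for j
    using part that by (auto simp: partition_on_def)
  have C_nonempty: "C j \<noteq> {}" if "j \<in> {1..k}" for j
    using part that by (auto simp: partition_on_def)
  have C_unique: "i = j" if "i \<in> {1..k}" "j \<in> {1..k}" "x \<in> C i" "x \<in> C j" for i j x
  proof -
    have "C i = C j" using disjointD[OF partition_onD2[OF part]] that by blast
    then show ?thesis using inj_C that by (auto dest: inj_onD)
  qed
  have C_ex: "\<exists>j. j \<in> {1..k} \<and> x \<in> C j" if "x \<in> words s" for x
    using partition_onD1[OF part] that by auto
  define cell where "cell x = (SOME j. j \<in> {1..k} \<and> x \<in> C j)" for x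
  have cell: "cell x \<in> {1..k}" "x \<in> C (cell x)" if "x \<in> words s" for x
    using someI_ex[OF C_ex[OF that]] by (auto simp: cell_def)
  define rep where "rep j = (SOME x. x \<in> C j)" for j
  have rep: "rep j \<in> C j" if "j \<in> {1..k}" for j
    using C_nonempty[OF that] by (auto simp: rep_def some_in_eq)
  have rep_words: "rep j \<in> words s" if "j \<in> {1..k}" for j
    using rep C_words that by blast
  have rep_inj: "i = j" if "i \<in> {1..k}" "j \<in> {1..k}" "rep i = rep j" for i j
    using C_unique rep that by metis
  define f where "f x = rep (cell x)" for x

  obtain a :: "nat \<Rightarrow> nat \<Rightarrow> 'f" where a: "bij_betw a {..<n} (normalized (s + 1))"
    "\<And>t. t \<le> s \<Longrightarrow> a t = unit_vec t" "s < n"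
    using exists_projective_enumeration assms(2,4) by metis
  interpret switching s n a f
  proof
    show "f x \<in> words s" if "x \<in> words s" for x
      using that rep_words cell by (simp add: f_def)
    show "hamming_dist x y \<ge> 3"
      if "x \<in> words s" "y \<in> words s" "f x = f y" "x \<noteq> y" for x y
    proof -
      \<comment> \<open>Disjoint cells have different representatives, so equal values of
        \<open>f\<close> mean a common cell, which is a 1-code.\<close>
      have "cell x = cell y" using rep_inj cell that by (simp add: f_def)
      then show ?thesis
        using one_code_hamming_dist[of s "C (cell x)"] assms(6) cell that by metis
    qed
  qed (use a in auto)

  have inj_colour: "inj_on (\<lambda>j. coords (0 # rep j)) {1..k}"
  proof (rule inj_onI)
    fix i j assume ij: "i \<in> {1..k}" "j \<in> {1..k}" "coords (0 # rep i) = coords (0 # rep j)"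
    then show "i = j" using coords_Cons_inj[of "rep i" s "rep j"] rep_words rep_inj by blast
  qed
  have sub: "(\<lambda>j. coords (0 # rep j)) ` {1..k} \<subseteq> ?V"
    using rep_words coords_Cons_in_vecs by blast
  have card_V: "card ?V = ?Q" using assms(2) by (simp only: card_vecs)
  have k_le: "k \<le> ?Q"
    using card_inj_on_le[OF inj_colour sub finite_vecs] card_V by simp
  \<comment> \<open>The colours are numbered so that code \<open>j\<close> has the colour given to
    the embedded words of cell \<open>j\<close>; the remaining colours are numbered
    arbitrarily.\<close>
  obtain g where g: "bij_betw g {1..?Q} ?V" "\<And>j. j \<in> {1..k} \<Longrightarrow> g j = coords (0 # rep j)"
    using inj_on_extends_to_bij_betw[OF _ finite_vecs _ _ inj_colour sub, of "{1..?Q}"] card_V k_le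
    by auto
  define P where "P i = {v \<in> words n. colour v = g i}" for i
  have perfect: "one_perfect n (P i)" if "i \<in> {1..?Q}" for i
    unfolding P_def using colour_bij_betw bij_betw_apply[OF g(1) that] by (rule one_perfect_fibre)
  have P_nonempty: "P i \<noteq> {}" if "i \<in> {1..?Q}" for i
  proof -
    \<comment> \<open>A perfect code has to cover this word, so it cannot be empty.\<close>
    have "replicate n 0 \<in> words n" by (simp add: words_def)
    then show ?thesis
      using perfect[OF that] by (auto simp: one_perfect_def neighborhood_def)
  qed
  have P_unique: "i = j" if "i \<in> {1..?Q}" "j \<in> {1..?Q}" "v \<in> P i" "v \<in> P j" for i j v
    using that inj_onD[OF bij_betw_imp_inj_on[OF g(1)], of i j] by (simp add: P_def)
  have "indexed_partition (words n) ?Q P"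
    unfolding indexed_partition_def
  proof (intro conjI partition_onI)
    show "inj_on P {1..?Q}"
      using P_nonempty P_unique by (intro inj_onI) blast
    show "\<Union> (P ` {1..?Q}) = words n"
    proof (intro equalityI subsetI)
      show "v \<in> words n" if "v \<in> \<Union> (P ` {1..?Q})" for v
        using that by (auto simp: P_def)
      fix v :: "'f list" assume v: "v \<in> words n"
      obtain i where "i \<in> {1..?Q}" "colour v = g i"
        using bij_betw_imp_surj_on[OF g(1)] colour_in_vecs by (metis imageE)
      then show "v \<in> \<Union> (P ` {1..?Q})" using v by (auto simp: P_def)
    qed
    show "disjnt p p'" if "p \<in> P ` {1..?Q}" "p' \<in> P ` {1..?Q}" "p \<noteq> p'" for p p'
      using that P_unique unfolding disjnt_iff by blast
    show "{} \<notin> P ` {1..?Q}" using P_nonempty by blast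
  qed
  moreover have "C j = {x \<in> words s. 1 # x @ replicate (n - s - 1) 0 \<in> P j}"
    if j: "j \<in> {1..k}" for j
  proof -
    have "embed x \<in> P j \<longleftrightarrow> x \<in> C j" if x: "x \<in> words s" for x
    proof -
      \<comment> \<open>After switching, the colour of an embedded word depends only on its cell,
        and different cells give different colours.\<close>
      have "embed x \<in> P j \<longleftrightarrow> coords (0 # rep (cell x)) = coords (0 # rep j)"
        using g(2)[OF j] colour_embed[OF x] embed_in_words[OF x] by (simp add: P_def f_def)
      also have "\<dots> \<longleftrightarrow> cell x = j"
        using inj_onD[OF inj_colour _ cell(1)[OF x] j] by auto
      also have "\<dots> \<longleftrightarrow> x \<in> C j"
        using cell[OF x] C_unique j by blast
      finally show ?thesis .
    qed
    then show ?thesis using C_words[OF j] by (auto simp: embed_def)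
  qed
  ultimately show ?thesis using k_le perfect by blast
qed

end
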